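(* Let $r,s$ be positive integers and let $a_1,\ldots,a_r,b_1,\ldots,b_s$ be nonnegative integers. Then in the shuffle algebra $(\mathfrak{h},\,\sqcup\!\sqcup\,)$, $$x^{a_1}y\cdots x^{a_r}y\;\sqcup\!\sqcup\; x^{b_1}y\cdots x^{b_s}y=\sum_{\substack{\alpha_1+\cdots+\alpha_{r+s}=\sum_{i=1}^r a_i+\sum_{j=1}^s b_j\\ \alpha_1,\ldots,\alpha_{r+s}\ge 0}} c_{\alpha_1,\ldots,\alpha_{r+s}}\, x^{\alpha_1}y x^{\alpha_2}y\cdots x^{\alpha_{r+s}}y,$$ where \begin{align*} c_{\alpha_1,\ldots,\alpha_{r+s}}=&\sum_{\substack{l_1+\cdots+l_{p+1}=r,\ n_1+\cdots+n_p=s\\ p\ge1,\ l_i\ge1,\ n_j\ge1}}\prod_{i=1}^{L_p+s}\binom{\alpha_i}{\beta_i}\prod_{j=L_p+s+2}^{r+s}\delta_{\alpha_j,a_{j-s}} +\sum_{\substack{l_1+\cdots+l_{p}=r,\ n_1+\cdots+n_p=s\\ p\ge1,\ l_i\ge1,\ n_j\ge1}}\prod_{i=1}^{r+N_{p-1}}\binom{\alpha_i}{\beta_i}\prod_{j=r+N_{p-1}+2}^{r+s}\delta_{\alpha_j,b_{j-r}}\\ &+\sum_{\substack{l_1+\cdots+l_{p}=r,\ n_1+\cdots+n_{p+1}=s\\ p\ge1,\ l_i\ge1,\ n_j\ge1}}\prod_{i=1}^{r+N_{p}}\binom{\alpha_i}{\gamma_i}\prod_{j=r+N_{p}+2}^{r+s}\delta_{\alpha_j,b_{j-r}}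 +\sum_{\substack{l_1+\cdots+l_{p}=r,\ n_1+\cdots+n_p=s\\ p\ge1,\ l_i\ge1,\ n_j\ge1}}\prod_{i=1}^{L_{p-1}+s}\binom{\alpha_i}{\gamma_i}\prod_{j=L_{p-1}+s+2}^{r+s}\delta_{\alpha_j,a_{j-s}}. \end{align*} Here, for the positive integers $l_1,\ldots,l_p(,l_{p+1})$ and $n_1,\ldots,n_p(,n_{p+1})$ occurring in each summation, $L_j=l_1+\cdots+l_j$, $N_j=n_1+\cdots+n_j$ ($L_0=N_0=0$), and the integers $\beta_i$ and $\gamma_i$ are defined by $$\begin{cases}\beta_{L_j+N_j+1}=\sum_{i=1}^{L_j+1}a_i+\sum_{i=1}^{N_j}b_i-\sum_{i=1}^{L_j+N_j}\alpha_i,\quad \beta_{L_j+N_j+t}=a_{L_j+t}\ (2\le t\le l_{j+1}), & j=0,1,\ldots,p,\\ \beta_{L_{j+1}+N_j+1}=\sum_{i=1}^{L_{j+1}}a_i+\sum_{i=1}^{N_j+1}b_i-\sum_{i=1}^{L_{j+1}+N_j}\alpha_i,\quad \beta_{L_{j+1}+N_j+t}=b_{N_j+t}\ (2\le t\le n_{j+1}), & j=0,1,\ldots,p-1,\end{cases}$$ and $$\begin{cases}\gamma_{L_j+N_j+1}=\sum_{i=1}^{L_j}a_i+\sum_{i=1}^{N_j+1}b_i-\sum_{i=1}^{L_j+N_j}\alpha_i,\quad \gamma_{L_j+N_j+t}=b_{N_j+t}\ (2\le t\le n_{j+1}), & j=0,1,\ldots,p,\\ \gamma_{L_j+N_{j+1}+1}=\sum_{i=1}^{L_j+1}a_i+\sum_{i=1}^{N_{j+1}}b_i-\sum_{i=1}^{L_j+N_{j+1}}\alpha_i,\quad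 \gamma_{L_j+N_{j+1}+t}=a_{L_j+t}\ (2\le t\le l_{j+1}), & j=0,1,\ldots,p-1,\end{cases}$$ (each defined whenever the indices involved are among the $l$'s and $n$'s of the given summation).
   Context: Let $A=\{x,y\}$ be an alphabet of two non-commuting letters, $A^*$ the set of words (including the empty word $1$), and $\mathfrak{h}=\mathbb{Q}\langle x,y\rangle$ the $\mathbb{Q}$-vector space spanned by $A^*$. The shuffle product $\sqcup\!\sqcup$ on $\mathfrak{h}$ is the $\mathbb{Q}$-bilinear product defined by $1\sqcup\!\sqcup w=w\sqcup\!\sqcup 1=w$ and $aw_1\sqcup\!\sqcup bw_2=a(w_1\sqcup\!\sqcup bw_2)+b(aw_1\sqcup\!\sqcup w_2)$ for letters $a,b\in A$ and words $w,w_1,w_2$. Conventions: $\delta_{ij}$ is the Kronecker delta; for integers $\alpha,\beta$ the binomial coefficient $\binom{\alpha}{\beta}$ is taken to be $0$ if $\beta<0$ or $\alpha<\beta$; empty products equal $1$. *)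

theory Defs
  imports Complex_Main "HOL-Library.Poly_Mapping" "HOL-Library.FuncSet"
begin

section \<open>The shuffle algebra over two letters\<close>

datatype letter = X | Y

text \<open>The space spanned by the words: finitely supported functions from words to
  rational coefficients.\<close>

type_synonym shuffle_space = "letter list \<Rightarrow>\<^sub>0 rat"

definition of_word :: "letter list \<Rightarrow> shuffle_space" where
  "of_word w = Poly_Mapping.single w 1"

definition scale :: "rat \<Rightarrow> shuffle_space \<Rightarrow> shuffle_space" where
  "scale q f = Poly_Mapping.map ((*) q) f"

text \<open>The linear extension of the map sending a word \<open>w\<close> to \<open>c # w\<close>.\<close>

definition prepend :: "letter \<Rightarrow> shuffle_space \<Rightarrow> shuffle_space" where
  "prepend c f = (\<Sum>w\<in>Poly_Mapping.keys f. scale (Poly_Mapping.lookup f w) (of_word (c # w)))"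

fun shuffle_words :: "letter list \<Rightarrow> letter list \<Rightarrow> shuffle_space" where
  "shuffle_words [] w = of_word w"
| "shuffle_words w [] = of_word w"
| "shuffle_words (c # u) (d # v) =
     prepend c (shuffle_words u (d # v)) + prepend d (shuffle_words (c # u) v)"

text \<open>The bilinear extension of the shuffle product of words.\<close>

definition shuffle :: "shuffle_space \<Rightarrow> shuffle_space \<Rightarrow> shuffle_space" (infixl \<open>\<squnion>\<squnion>\<close> 70) where
  "f \<squnion>\<squnion> g = (\<Sum>u\<in>Poly_Mapping.keys f. \<Sum>v\<in>Poly_Mapping.keys g.
     scale (Poly_Mapping.lookup f u * Poly_Mapping.lookup g v) (shuffle_words u v))"

text \<open>The word $x^{e_1} y x^{e_2} y \cdots x^{e_k} y$. All families of exponents are indexed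
  from 1.\<close>

definition xy_word :: "nat \<Rightarrow> (nat \<Rightarrow> nat) \<Rightarrow> letter list" where
  "xy_word k e = concat (map (\<lambda>i. replicate (e i) X @ [Y]) [1..<Suc k])"

lemma lookup_scale: "Poly_Mapping.lookup (scale q f) w = q * Poly_Mapping.lookup f w"
  by (simp add: scale_def Poly_Mapping.map.rep_eq when_def)

lemma scale_simps [simp]:
  "scale 0 f = 0" "scale q 0 = 0" "scale 1 f = f"
  by (auto intro!: poly_mapping_eqI simp: lookup_scale)

lemma scale_add_left: "scale (p + q) f = scale p f + scale q f"
  and scale_add_right: "scale q (f + g) = scale q f + scale q g"
  and scale_scale: "scale p (scale q f) = scale (p * q) f"
  by (auto intro!: poly_mapping_eqI simp: lookup_scale lookup_add algebra_simps)

lemma scale_sum: "scale q (sum F A) = (\<Sum>i\<in>A. scale q (F i))"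
  by (induction A rule: infinite_finite_induct) (auto simp: scale_add_right)

lemma keys_of_word [simp]: "Poly_Mapping.keys (of_word w) = {w}"
  and lookup_of_word [simp]: "Poly_Mapping.lookup (of_word w) w = 1"
  by (auto simp: of_word_def)

lemma sum_keys_extend:
  assumes "finite A" "Poly_Mapping.keys f \<subseteq> A"
  shows "(\<Sum>w\<in>Poly_Mapping.keys f. scale (Poly_Mapping.lookup f w) (F w)) =
    (\<Sum>w\<in>A. scale (Poly_Mapping.lookup f w) (F w))"
  using assms by (intro sum.mono_neutral_left) (auto simp: in_keys_iff)

lemma sum_keys_add:
  "(\<Sum>w\<in>Poly_Mapping.keys (f + g). scale (Poly_Mapping.lookup (f + g) w) (F w)) =
   (\<Sum>w\<in>Poly_Mapping.keys f. scale (Poly_Mapping.lookup f w) (F w)) +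
   (\<Sum>w\<in>Poly_Mapping.keys g. scale (Poly_Mapping.lookup g w) (F w))"
proof -
  let ?A = "Poly_Mapping.keys f \<union> Poly_Mapping.keys g"
  have "Poly_Mapping.keys (f + g) \<subseteq> ?A" by (rule Poly_Mapping.keys_add)
  then show ?thesis
    using sum_keys_extend[of ?A "f + g" F] sum_keys_extend[of ?A f F] sum_keys_extend[of ?A g F]
    by (simp only: lookup_add scale_add_left sum.distrib finite_Un finite_keys Un_upper1 Un_upper2)
qed

lemma sum_keys_scale:
  "(\<Sum>w\<in>Poly_Mapping.keys (scale q f). scale (Poly_Mapping.lookup (scale q f) w) (F w)) =
   scale q (\<Sum>w\<in>Poly_Mapping.keys f. scale (Poly_Mapping.lookup f w) (F w))"
proof -
  have "Poly_Mapping.keys (scale q f) \<subseteq> Poly_Mapping.keys f"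
    by (auto simp: in_keys_iff lookup_scale)
  then show ?thesis
    using sum_keys_extend[of "Poly_Mapping.keys f" "scale q f" F]
    by (simp only: lookup_scale scale_scale scale_sum finite_keys)
qed

lemma prepend_of_word: "prepend c (of_word w) = of_word (c # w)"
  by (simp add: prepend_def)

lemma prepend_add: "prepend c (f + g) = prepend c f + prepend c g"
  and prepend_scale: "prepend c (scale q f) = scale q (prepend c f)"
  by (simp_all add: prepend_def sum_keys_add sum_keys_scale)

lemma shuffle_of_word: "of_word u \<squnion>\<squnion> of_word v = shuffle_words u v"
  by (simp add: shuffle_def)

lemma shuffle_words_Nil [simp]: "shuffle_words w [] = of_word w"
  by (cases w) auto

lemma shuffle_altdef:
  "f \<squnion>\<squnion> g = (\<Sum>u\<in>Poly_Mapping.keys f. scale (Poly_Mapping.lookup f u)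
     (\<Sum>v\<in>Poly_Mapping.keys g. scale (Poly_Mapping.lookup g v) (shuffle_words u v)))"
  by (simp add: shuffle_def scale_sum scale_scale)

lemma shuffle_bilinear:
  "(f + f') \<squnion>\<squnion> g = f \<squnion>\<squnion> g + f' \<squnion>\<squnion> g"
  "f \<squnion>\<squnion> (g + g') = f \<squnion>\<squnion> g + f \<squnion>\<squnion> g'"
  "scale q f \<squnion>\<squnion> g = scale q (f \<squnion>\<squnion> g)"
  "f \<squnion>\<squnion> scale q g = scale q (f \<squnion>\<squnion> g)"
proof -
  show "(f + f') \<squnion>\<squnion> g = f \<squnion>\<squnion> g + f' \<squnion>\<squnion> g"
    unfolding shuffle_altdef by (rule sum_keys_add)
  show "f \<squnion>\<squnion> (g + g') = f \<squnion>\<squnion> g + f \<squnion>\<squnion> g'"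
    unfolding shuffle_altdef sum_keys_add scale_add_right sum.distrib ..
  show "scale q f \<squnion>\<squnion> g = scale q (f \<squnion>\<squnion> g)"
    unfolding shuffle_altdef by (rule sum_keys_scale)
  show "f \<squnion>\<squnion> scale q g = scale q (f \<squnion>\<squnion> g)"
  proof -
    have "scale p (scale q h) = scale q (scale p h)" for p h
      by (simp add: scale_scale mult.commute)
    then show ?thesis
      unfolding shuffle_altdef sum_keys_scale
      by (simp only: scale_sum[symmetric])
  qed
qed


section \<open>The coefficients\<close>

text \<open>Only the convention for integer arguments differs from the library: the value is 0
  unless \<open>0 \<le> \<beta> \<le> \<alpha>\<close>.\<close>

definition binom :: "int \<Rightarrow> int \<Rightarrow> nat" where
  "binom \<alpha> \<beta> = (if \<beta> < 0 \<or> \<alpha> < \<beta> then 0 else nat \<alpha> choose nat \<beta>)"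

text \<open>A tuple $(l_1, \ldots, l_k)$ of positive integers is a list, so that \<open>l ! j\<close> is
  $l_{j+1}$ and \<open>psum l j\<close> is $l_1 + \cdots + l_j$.\<close>

definition compositions :: "nat \<Rightarrow> nat \<Rightarrow> nat list set" where
  "compositions k m = {l. length l = k \<and> (\<forall>x\<in>set l. 1 \<le> x) \<and> sum_list l = m}"

definition psum :: "nat list \<Rightarrow> nat \<Rightarrow> nat" where
  "psum l j = sum_list (take j l)"

text \<open>\<open>beta_at a b \<alpha> l n i v\<close> says that one of the equations defining $\beta$ assigns the
  value \<open>v\<close> to $\beta_i$. An equation is present whenever the part $l_{j+1}$ or $n_{j+1}$ whose
  block it describes exists; \<open>beta_eqs\<close> and \<open>gamma_eqs\<close> below show that the equations do not
  conflict.\<close>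

inductive beta_at ::
  "(nat \<Rightarrow> nat) \<Rightarrow> (nat \<Rightarrow> nat) \<Rightarrow> (nat \<Rightarrow> nat) \<Rightarrow> nat list \<Rightarrow> nat list \<Rightarrow> nat \<Rightarrow> int \<Rightarrow> bool"
  for a b \<alpha> l n where
  "j < length l \<Longrightarrow> beta_at a b \<alpha> l n (psum l j + psum n j + 1)
     ((\<Sum>i=1..psum l j + 1. int (a i)) + (\<Sum>i=1..psum n j. int (b i))
        - (\<Sum>i=1..psum l j + psum n j. int (\<alpha> i)))"
| "j < length l \<Longrightarrow> 2 \<le> t \<Longrightarrow> t \<le> l ! j \<Longrightarrow>
     beta_at a b \<alpha> l n (psum l j + psum n j + t) (int (a (psum l j + t)))"
| "j < length n \<Longrightarrow> beta_at a b \<alpha> l n (psum l (j + 1) + psum n j + 1)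
     ((\<Sum>i=1..psum l (j + 1). int (a i)) + (\<Sum>i=1..psum n j + 1. int (b i))
        - (\<Sum>i=1..psum l (j + 1) + psum n j. int (\<alpha> i)))"
| "j < length n \<Longrightarrow> 2 \<le> t \<Longrightarrow> t \<le> n ! j \<Longrightarrow>
     beta_at a b \<alpha> l n (psum l (j + 1) + psum n j + t) (int (b (psum n j + t)))"

inductive gamma_at ::
  "(nat \<Rightarrow> nat) \<Rightarrow> (nat \<Rightarrow> nat) \<Rightarrow> (nat \<Rightarrow> nat) \<Rightarrow> nat list \<Rightarrow> nat list \<Rightarrow> nat \<Rightarrow> int \<Rightarrow> bool"
  for a b \<alpha> l n where
  "j < length n \<Longrightarrow> gamma_at a b \<alpha> l n (psum l j + psum n j + 1)
     ((\<Sum>i=1..psum l j. int (a i)) + (\<Sum>i=1..psum n j + 1. int (b i))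
        - (\<Sum>i=1..psum l j + psum n j. int (\<alpha> i)))"
| "j < length n \<Longrightarrow> 2 \<le> t \<Longrightarrow> t \<le> n ! j \<Longrightarrow>
     gamma_at a b \<alpha> l n (psum l j + psum n j + t) (int (b (psum n j + t)))"
| "j < length l \<Longrightarrow> gamma_at a b \<alpha> l n (psum l j + psum n (j + 1) + 1)
     ((\<Sum>i=1..psum l j + 1. int (a i)) + (\<Sum>i=1..psum n (j + 1). int (b i))
        - (\<Sum>i=1..psum l j + psum n (j + 1). int (\<alpha> i)))"
| "j < length l \<Longrightarrow> 2 \<le> t \<Longrightarrow> t \<le> l ! j \<Longrightarrow>
     gamma_at a b \<alpha> l n (psum l j + psum n (j + 1) + t) (int (a (psum l j + t)))"

definition beta ::
  "(nat \<Rightarrow> nat) \<Rightarrow> (nat \<Rightarrow> nat) \<Rightarrow> (nat \<Rightarrow> nat) \<Rightarrow> nat list \<Rightarrow> nat list \<Rightarrow> nat \<Rightarrow> int" where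
  "beta a b \<alpha> l n i = (THE v. beta_at a b \<alpha> l n i v)"

definition gamma ::
  "(nat \<Rightarrow> nat) \<Rightarrow> (nat \<Rightarrow> nat) \<Rightarrow> (nat \<Rightarrow> nat) \<Rightarrow> nat list \<Rightarrow> nat list \<Rightarrow> nat \<Rightarrow> int" where
  "gamma a b \<alpha> l n i = (THE v. gamma_at a b \<alpha> l n i v)"

definition shuffle_coeff ::
  "nat \<Rightarrow> nat \<Rightarrow> (nat \<Rightarrow> nat) \<Rightarrow> (nat \<Rightarrow> nat) \<Rightarrow> (nat \<Rightarrow> nat) \<Rightarrow> nat" where
  "shuffle_coeff r s a b \<alpha> =
     (\<Sum>(p, l, n) \<in> (SIGMA p:{1..}. compositions (p + 1) r \<times> compositions p s).
        (\<Prod>i=1..psum l p + s. binom (int (\<alpha> i)) (beta a b \<alpha> l n i)) *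
        (\<Prod>j=psum l p + s + 2..r + s. of_bool (\<alpha> j = a (j - s))))
   + (\<Sum>(p, l, n) \<in> (SIGMA p:{1..}. compositions p r \<times> compositions p s).
        (\<Prod>i=1..r + psum n (p - 1). binom (int (\<alpha> i)) (beta a b \<alpha> l n i)) *
        (\<Prod>j=r + psum n (p - 1) + 2..r + s. of_bool (\<alpha> j = b (j - r))))
   + (\<Sum>(p, l, n) \<in> (SIGMA p:{1..}. compositions p r \<times> compositions (p + 1) s).
        (\<Prod>i=1..r + psum n p. binom (int (\<alpha> i)) (gamma a b \<alpha> l n i)) *
        (\<Prod>j=r + psum n p + 2..r + s. of_bool (\<alpha> j = b (j - r))))
   + (\<Sum>(p, l, n) \<in> (SIGMA p:{1..}. compositions p r \<times> compositions p s).
        (\<Prod>i=1..psum l (p - 1) + s. binom (int (\<alpha> i)) (gamma a b \<alpha> l n i)) *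
        (\<Prod>j=psum l (p - 1) + s + 2..r + s. of_bool (\<alpha> j = a (j - s))))"

definition weak_compositions :: "nat \<Rightarrow> nat \<Rightarrow> (nat \<Rightarrow> nat) set" where
  "weak_compositions k m = {\<alpha> \<in> {1..k} \<rightarrow>\<^sub>E UNIV. (\<Sum>i=1..k. \<alpha> i) = m}"


subsection \<open>Well-definedness\<close>

text \<open>The index sets of all sums are finite.\<close>

lemma finite_weak_compositions: "finite (weak_compositions k m)"
proof (rule finite_subset)
  show "weak_compositions k m \<subseteq> {1..k} \<rightarrow>\<^sub>E {..m}"
  proof
    fix \<alpha> assume *: "\<alpha> \<in> weak_compositions k m"
    have "\<alpha> i \<le> m" if "i \<in> {1..k}" for i
      using * member_le_sum[of i "{1..k}" \<alpha>] that by (auto simp: weak_compositions_def)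
    with * show "\<alpha> \<in> {1..k} \<rightarrow>\<^sub>E {..m}"
      unfolding weak_compositions_def PiE_def by blast
  qed
qed (auto intro: finite_PiE)

lemma length_le_sum_list: "(\<forall>x\<in>set l. 1 \<le> x) \<Longrightarrow> length l \<le> sum_list (l :: nat list)"
  by (induction l) auto

lemma finite_compositions: "finite (compositions k m)"
proof (rule finite_subset)
  show "compositions k m \<subseteq> {l. set l \<subseteq> {..m} \<and> length l = k}"
    by (auto simp: compositions_def intro: member_le_sum_list)
qed (auto intro: finite_lists_length_eq)

lemma compositions_empty: "m < k \<Longrightarrow> compositions k m = {}"
  using length_le_sum_list by (fastforce simp: compositions_def)

lemma finite_composition_pairs:
  assumes "\<And>p. p \<le> f p"
  shows "finite (SIGMA p:{1..}. compositions (f p) r \<times> compositions (g p) s)"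
proof (rule finite_subset)
  show "(SIGMA p:{1..}. compositions (f p) r \<times> compositions (g p) s)
    \<subseteq> (SIGMA p:{1..r}. compositions (f p) r \<times> compositions (g p) s)"
  proof
    fix x assume x: "x \<in> (SIGMA p:{1..}. compositions (f p) r \<times> compositions (g p) s)"
    then obtain p l n where "x = (p, l, n)" "1 \<le> p" "l \<in> compositions (f p) r" by auto
    then have "f p \<le> r" using compositions_empty[of r "f p"] by (metis empty_iff leI)
    then have "p \<le> r" using assms[of p] by simp
    with x \<open>x = (p, l, n)\<close>
    show "x \<in> (SIGMA p:{1..r}. compositions (f p) r \<times> compositions (g p) s)" by auto
  qed
qed (auto intro: finite_compositions)

text \<open>Under the conditions on \<open>l\<close> and \<open>n\<close> in the sums above, \<open>beta\<close> and \<open>gamma\<close> satisfy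
  their defining equations.\<close>

lemma psum_Suc: "j < length l \<Longrightarrow> psum l (Suc j) = psum l j + l ! j"
  by (simp add: psum_def take_Suc_conv_app_nth)

lemma psum_mono: "j \<le> k \<Longrightarrow> psum l j \<le> psum l k"
  unfolding psum_def
  by (metis le_add1 min.absorb1 sum_list_append take_add le_add_diff_inverse)

lemma beta_at_unique:
  assumes pos: "\<forall>x\<in>set l. 1 \<le> x" "\<forall>x\<in>set n. 1 \<le> x"
    and len: "length n \<le> length l"
    and "beta_at a b \<alpha> l n i v" "beta_at a b \<alpha> l n i w"
  shows "v = w"
proof -
  have blkA: "j = k" if "j < length l" "k < length l" "psum l j + psum n j < i"
    "i \<le> psum l j + psum n j + l ! j" "psum l k + psum n k < i" "i \<le> psum l k + psum n k + l ! k" for j k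
  proof -
    have False if "j' < k'" "j' < length l" "i \<le> psum l j' + psum n j' + l ! j'"
      "psum l k' + psum n k' < i" for j' k'
      using psum_Suc[of j' l] psum_mono[of "Suc j'" k' l] psum_mono[of j' k' n] that by simp
    then show ?thesis using that by (metis linorder_neqE_nat)
  qed
  have blkB: "j = k" if "j < length n" "k < length n" "psum l (Suc j) + psum n j < i"
    "i \<le> psum l (Suc j) + psum n j + n ! j" "psum l (Suc k) + psum n k < i"
    "i \<le> psum l (Suc k) + psum n k + n ! k" for j k
  proof -
    have False if "j' < k'" "j' < length n" "i \<le> psum l (Suc j') + psum n j' + n ! j'"
      "psum l (Suc k') + psum n k' < i" for j' k'
      using psum_Suc[of j' n] psum_mono[of "Suc j'" k' n] psum_mono[of "Suc j'" "Suc k'" l] that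
      by simp
    then show ?thesis using that by (metis linorder_neqE_nat)
  qed
  have blkAB: False if "j < length l" "k < length n" "psum l j + psum n j < i"
    "i \<le> psum l j + psum n j + l ! j" "psum l (Suc k) + psum n k < i"
    "i \<le> psum l (Suc k) + psum n k + n ! k" for j k
  proof (cases "j \<le> k")
    case True
    then show False
      using that psum_Suc[of j l] psum_mono[of "Suc j" "Suc k" l] psum_mono[of j k n] by simp
  next
    case False
    then show False
      using that psum_Suc[of k n] psum_mono[of "Suc k" j l] psum_mono[of "Suc k" j n] by simp
  qed
  have l1: "1 \<le> l ! j" if "j < length l" for j using pos that by auto
  have n1: "1 \<le> n ! j" if "j < length n" for j using pos that by auto
  define RA where "RA j t v \<longleftrightarrow> j < length l \<and> 1 \<le> t \<and> t \<le> l ! j \<and> i = psum l j + psum n j + t \<and>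
    v = (if t = 1 then (\<Sum>i=1..psum l j + 1. int (a i)) + (\<Sum>i=1..psum n j. int (b i))
        - (\<Sum>i=1..psum l j + psum n j. int (\<alpha> i)) else int (a (psum l j + t)))" for j t v
  define RB where "RB j t v \<longleftrightarrow> j < length n \<and> 1 \<le> t \<and> t \<le> n ! j \<and> i = psum l (Suc j) + psum n j + t \<and>
    v = (if t = 1 then (\<Sum>i=1..psum l (Suc j). int (a i)) + (\<Sum>i=1..psum n j + 1. int (b i))
        - (\<Sum>i=1..psum l (Suc j) + psum n j. int (\<alpha> i)) else int (b (psum n j + t)))" for j t v
  have R: "\<exists>j t. RA j t v \<or> RB j t v" if "beta_at a b \<alpha> l n i v" for v
    using that
  proof cases
    case (1 j) then have "RA j 1 v" using l1[of j] by (simp add: RA_def) then show ?thesis by blast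
  next
    case (2 j t) then have "RA j t v" by (simp add: RA_def) then show ?thesis by blast
  next
    case (3 j) then have "RB j 1 v" using n1[of j] by (simp add: RB_def) then show ?thesis by blast
  next
    case (4 j t) then have "RB j t v" by (simp add: RB_def) then show ?thesis by blast
  qed
  have AA: "v = w" if "RA j t v" "RA k u w" for j k t u v w
    using that blkA[of j k] unfolding RA_def by auto
  have BB: "v = w" if "RB j t v" "RB k u w" for j k t u v w
    using that blkB[of j k] unfolding RB_def by auto
  have AB: False if "RA j t v" "RB k u w" for j k t u v w
    using that blkAB[of j k] unfolding RA_def RB_def by auto
  from R[OF assms(4)] R[OF assms(5)] show ?thesis using AA BB AB by blast
qed

lemma gamma_at_iff_beta_at: "gamma_at a b \<alpha> l n i v \<longleftrightarrow> beta_at b a \<alpha> n l i v"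
proof
  assume "gamma_at a b \<alpha> l n i v"
  then show "beta_at b a \<alpha> n l i v"
    by cases (auto simp: beta_at.simps add.commute)
next
  assume "beta_at b a \<alpha> n l i v"
  then show "gamma_at a b \<alpha> l n i v"
    by cases (auto simp: gamma_at.simps add.commute)
qed

lemma beta_eqs:
  assumes "\<forall>x\<in>set l. 1 \<le> x" "\<forall>x\<in>set n. 1 \<le> x" "length n \<le> length l"
    and "beta_at a b \<alpha> l n i v"
  shows "beta a b \<alpha> l n i = v"
  unfolding beta_def using assms beta_at_unique by (blast intro: the_equality)

lemma gamma_eqs:
  assumes "\<forall>x\<in>set l. 1 \<le> x" "\<forall>x\<in>set n. 1 \<le> x" "length l \<le> length n"
    and "gamma_at a b \<alpha> l n i v"
  shows "gamma a b \<alpha> l n i = v"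
  using assms beta_eqs[of n l b a \<alpha> i v]
  by (simp add: gamma_def beta_def gamma_at_iff_beta_at)

end

(* Compare coefficients of a fixed word x^{\<alpha>_1} y ... x^{\<alpha>_{r+s}} y. Up to the first y, a shuffle mixes
   the leading blocks of both words; if this y comes from the first word, the gap contains all of
   x^{a_1} and \<alpha>_1 - a_1 letters of x^{b_1}, in (\<alpha>_1 choose a_1) arrangements, and the rest is a shuffle
   of x^{a_2} y ... with x^{a_1 + b_1 - \<alpha>_1} y x^{b_2} y .... The sums defining the coefficient run over
   the interleavings of the two sets of y's, encoded by run lengths: l_j of them from the first word,
   then n_j from the second. Removing the first y either shortens the run l_1 or, if l_1 = 1, swaps the
   roles of the two words, and the values beta are compatible with this. Hence both sides satisfy the
   same recursion. The sums with gamma are those with beta for the two words exchanged. *)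

theory Submission
  imports Defs
begin

section \<open>Coefficients of the shuffle product\<close>

definition shift :: "(nat \<Rightarrow> 'a) \<Rightarrow> nat \<Rightarrow> 'a" where
  "shift f i = f (Suc i)"

lemma xy_word_0 [simp]: "xy_word 0 e = []"
  by (simp add: xy_word_def)

lemma xy_word_Suc: "xy_word (Suc k) e = replicate (e 1) X @ Y # xy_word k (shift e)"
proof -
  have "[1..<Suc (Suc k)] = 1 # map Suc [1..<Suc k]"
    by (simp add: upt_conv_Cons map_Suc_upt del: upt_Suc)
  then show ?thesis
    by (simp add: xy_word_def shift_def o_def del: upt_Suc)
qed

lemma xy_word_cong: "(\<And>i. 1 \<le> i \<Longrightarrow> i \<le> k \<Longrightarrow> e i = e' i) \<Longrightarrow> xy_word k e = xy_word k e'"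
  unfolding xy_word_def by (intro arg_cong[where f = concat] map_cong) auto

lemma replicate_X_eq_iff:
  "replicate m X @ Y # u = replicate n X @ Y # v \<longleftrightarrow> m = n \<and> u = v"
proof (induction m arbitrary: n)
  case 0
  show ?case by (cases n) auto
next
  case (Suc m)
  then show ?case by (cases n) auto
qed

lemma xy_word_eq_iff: "xy_word k e = xy_word k e' \<longleftrightarrow> (\<forall>i\<in>{1..k}. e i = e' i)"
proof (induction k arbitrary: e e')
  case (Suc k)
  have "{1..Suc k} = insert 1 (Suc ` {1..k})"
    by (auto simp: image_Suc_atLeastAtMost)
  then have "(\<forall>i\<in>{1..Suc k}. e i = e' i) \<longleftrightarrow> e 1 = e' 1 \<and> (\<forall>i\<in>{1..k}. shift e i = shift e' i)"
    by (simp only: ball_simps shift_def)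
  with Suc show ?case
    by (simp only: xy_word_Suc replicate_X_eq_iff)
qed simp

lemma xy_word_count:
  "count_list (xy_word k e) X = (\<Sum>i=1..k. e i)" "count_list (xy_word k e) Y = k"
proof -
  have "count_list (replicate m X) X = m" "count_list (replicate m X) Y = 0" for m
    by (induction m) auto
  then show "count_list (xy_word k e) X = (\<Sum>i=1..k. e i)" "count_list (xy_word k e) Y = k"
    by (induction k) (simp_all add: xy_word_def count_list_append)
qed

lemma last_xy_word: "1 \<le> k \<Longrightarrow> xy_word k e \<noteq> [] \<and> last (xy_word k e) = Y"
  by (cases k) (simp_all add: xy_word_def)

text \<open>Built from the back: a new leading x raises the first exponent, a new leading y inserts
  a first exponent 0. This serves to show that no other words occur in the shuffle.\<close>

lemma ends_in_Y_imp_xy_word: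
  "w = [] \<or> last w = Y \<Longrightarrow> \<exists>k e. w = xy_word k e"
proof (induction w)
  case Nil
  show ?case by (metis xy_word_0)
next
  case (Cons c w)
  show ?case
  proof (cases c)
    case X
    with Cons.prems have w: "w \<noteq> [] \<and> last w = Y" by (auto split: if_splits)
    with Cons.IH obtain k e where e: "w = xy_word k e" by auto
    with w obtain k' where "k = Suc k'" by (cases k) auto
    moreover have "xy_word k' (shift (e(1 := Suc (e 1)))) = xy_word k' (shift e)"
      by (rule xy_word_cong) (simp add: shift_def)
    ultimately have "c # w = xy_word k (e(1 := Suc (e 1)))"
      using e X by (simp add: xy_word_Suc)
    then show ?thesis by blast
  next
    case Y
    from Cons obtain k e where e: "w = xy_word k e" by (auto split: if_splits)
    with Y have "c # w = xy_word (Suc k) (\<lambda>i. if i = 1 then 0 else e (i - 1))"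
      by (auto simp: xy_word_Suc shift_def intro!: xy_word_cong)
    then show ?thesis by blast
  qed
qed

section \<open>Support and coefficients of a shuffle of two words\<close>

lemma lookup_prepend:
  "Poly_Mapping.lookup (prepend c f) w =
     (case w of [] \<Rightarrow> 0 | d # v \<Rightarrow> if c = d then Poly_Mapping.lookup f v else 0)"
proof -
  have "Poly_Mapping.lookup (prepend c f) w =
    (\<Sum>u\<in>Poly_Mapping.keys f. Poly_Mapping.lookup f u * of_bool (c # u = w))"
    unfolding prepend_def lookup_sum
    by (intro sum.cong) (auto simp: lookup_scale of_word_def lookup_single when_def)
  also have "\<dots> = (case w of [] \<Rightarrow> 0 | d # v \<Rightarrow> if c = d then Poly_Mapping.lookup f v else 0)"
  proof (cases w)
    case (Cons d v)
    have "(\<Sum>u\<in>Poly_Mapping.keys f. Poly_Mapping.lookup f u * of_bool (c # u = w)) =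
      (\<Sum>u\<in>Poly_Mapping.keys f. if u = v then of_bool (c = d) * Poly_Mapping.lookup f v else 0)"
      using Cons by (intro sum.cong) auto
    then show ?thesis using Cons by (simp add: in_keys_iff)
  qed simp
  finally show ?thesis .
qed

lemma lookup_of_word': "Poly_Mapping.lookup (of_word u) w = of_bool (u = w)"
  by (auto simp: of_word_def lookup_single when_def)

text \<open>Shuffling only interleaves letters, so it keeps their numbers and ends with the last
  letter of one of the words.\<close>

lemma lookup_shuffle_words_neq_0:
  assumes "Poly_Mapping.lookup (shuffle_words u v) w \<noteq> 0"
  shows "count_list w c = count_list u c + count_list v c"
    and "u = [] \<or> last u = Y \<Longrightarrow> v = [] \<or> last v = Y \<Longrightarrow> w = [] \<or> last w = Y"
proof -
  \<comment> \<open>The third conjunct strengthens the induction: the word left after removing one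
    letter is nonempty, so its last letter is that of \<open>w\<close>.\<close>
  have "count_list w c = count_list u c + count_list v c \<and>
    ((u = [] \<or> last u = Y) \<and> (v = [] \<or> last v = Y) \<longrightarrow> w = [] \<or> last w = Y) \<and>
    (w = [] \<longrightarrow> u = [] \<and> v = [])"
    using assms
  proof (induction u v arbitrary: w rule: shuffle_words.induct)
    case (3 c u d v)
    then obtain e w' where w: "w = e # w'"
      by (cases w) (auto simp: lookup_add lookup_prepend)
    with 3(3) consider "e = c" "Poly_Mapping.lookup (shuffle_words u (d # v)) w' \<noteq> 0"
      | "e = d" "Poly_Mapping.lookup (shuffle_words (c # u) v) w' \<noteq> 0"
      by (cases "c = e"; cases "d = e") (fastforce simp: lookup_add lookup_prepend)+
    then show ?case
    proof cases
      case 1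
      with 3(1)[OF 1(2)] w show ?thesis by auto
    next
      case 2
      with 3(2)[OF 2(2)] w show ?thesis by auto
    qed
  qed (auto simp: lookup_of_word')
  then show "count_list w c = count_list u c + count_list v c"
    and "u = [] \<or> last u = Y \<Longrightarrow> v = [] \<or> last v = Y \<Longrightarrow> w = [] \<or> last w = Y"
    by auto
qed

text \<open>Induction on \<open>\<alpha>\<close>, removing one x at a time. If both leading blocks
  can supply it, the binomials add up by Pascal's rule; the number \<open>a + b - \<alpha>\<close>
  of x's that remain is the same in either case.\<close>

lemma lookup_shuffle_words_step:
  "Poly_Mapping.lookup (shuffle_words (replicate a X @ Y # u) (replicate b X @ Y # v))
       (replicate \<alpha> X @ Y # w) =
     (if \<alpha> \<le> a + b then
        of_nat (\<alpha> choose a) *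
          Poly_Mapping.lookup (shuffle_words u (replicate (a + b - \<alpha>) X @ Y # v)) w +
        of_nat (\<alpha> choose b) *
          Poly_Mapping.lookup (shuffle_words (replicate (a + b - \<alpha>) X @ Y # u) v) w
      else 0)"
proof (induction \<alpha> arbitrary: a b)
  case 0
  show ?case by (cases a; cases b) (simp_all add: lookup_add lookup_prepend)
next
  case (Suc \<alpha>)
  show ?case
  proof (cases a; cases b)
    fix a' b' assume "a = Suc a'" "b = Suc b'"
    then show ?thesis
      using Suc.IH[of a' "Suc b'"] Suc.IH[of "Suc a'" b']
      by (simp add: lookup_add lookup_prepend algebra_simps)
  next
    fix b' assume "a = 0" "b = Suc b'"
    then show ?thesis using Suc.IH[of 0 b'] by (simp add: lookup_add lookup_prepend)
  next
    fix a' assume "a = Suc a'" "b = 0"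
    then show ?thesis using Suc.IH[of a' 0] by (simp add: lookup_add lookup_prepend)
  qed (simp add: lookup_add lookup_prepend)
qed

section \<open>Removing the first y from an interleaving\<close>

text \<open>After its first \<open>y\<close> is removed, the first word loses its block, and the
  \<open>x\<close>'s of the gap that did not come from this block came from the first block of \<open>b\<close>.\<close>

definition absorb :: "(nat \<Rightarrow> nat) \<Rightarrow> (nat \<Rightarrow> nat) \<Rightarrow> (nat \<Rightarrow> nat) \<Rightarrow> nat \<Rightarrow> nat" where
  "absorb a b \<alpha> = b(1 := a 1 + b 1 - \<alpha> 1)"

lemma sum_split_first: "1 \<le> m \<Longrightarrow> sum f {1..m} = f 1 + sum f {2..m :: nat}"
  by (simp add: sum.atLeast_Suc_atMost numeral_2_eq_2)

lemma sum_shift: "(\<Sum>i=1..m. int (shift f i)) = (\<Sum>i=1..Suc m. int (f i)) - int (f 1)"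
  by (induction m) (simp_all add: shift_def)

text \<open>Only the first entry differs, and \<open>\<alpha> 1 \<le> a 1 + b 1\<close> makes the
  truncated subtraction in \<open>absorb\<close> exact. An empty sum would not see the change, hence
  \<open>1 \<le> m\<close>.\<close>

lemma sum_absorb:
  assumes "\<alpha> 1 \<le> a 1 + b 1" "1 \<le> m"
  shows "(\<Sum>i=1..m. int (absorb a b \<alpha> i)) = (\<Sum>i=1..m. int (b i)) + int (a 1) - int (\<alpha> 1)"
proof -
  have "(\<Sum>i=2..m. int (absorb a b \<alpha> i)) = (\<Sum>i=2..m. int (b i))"
    by (intro sum.cong) (auto simp: absorb_def)
  then show ?thesis
    unfolding sum_split_first[OF assms(2)] using assms(1) by (simp add: absorb_def)
qed

lemma shift_Suc: "shift f (Suc i) = f (Suc (Suc i))"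
  by (simp add: shift_def)

lemmas sum_shift' = sum_shift[unfolded One_nat_def]
  and sum_absorb' = sum_absorb[unfolded One_nat_def]

section \<open>The equations for \<beta> before and after the removal\<close>

lemma psum_0 [simp]: "psum l 0 = 0" and psum_Cons [simp]: "psum (k # l) (Suc j) = k + psum l j"
  by (simp_all add: psum_def)

lemma psum_Suc_pos: "n \<noteq> [] \<Longrightarrow> \<forall>x\<in>set n. 1 \<le> x \<Longrightarrow> 1 \<le> psum n (Suc j)"
  by (cases n) auto

text \<open>The index and the value become variables, so that the rules apply up to
  arithmetic.\<close>

lemma beta_at_intros':
  "j < length l \<Longrightarrow> i = psum l j + psum n j + 1 \<Longrightarrow>
    v = (\<Sum>i=1..psum l j + 1. int (a i)) + (\<Sum>i=1..psum n j. int (b i))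
        - (\<Sum>i=1..psum l j + psum n j. int (\<alpha> i)) \<Longrightarrow> beta_at a b \<alpha> l n i v"
  "j < length l \<Longrightarrow> 2 \<le> t \<Longrightarrow> t \<le> l ! j \<Longrightarrow> i = psum l j + psum n j + t \<Longrightarrow>
    v = int (a (psum l j + t)) \<Longrightarrow> beta_at a b \<alpha> l n i v"
  "j < length n \<Longrightarrow> i = psum l (Suc j) + psum n j + 1 \<Longrightarrow>
    v = (\<Sum>i=1..psum l (Suc j). int (a i)) + (\<Sum>i=1..psum n j + 1. int (b i))
        - (\<Sum>i=1..psum l (Suc j) + psum n j. int (\<alpha> i)) \<Longrightarrow> beta_at a b \<alpha> l n i v"
  "j < length n \<Longrightarrow> 2 \<le> t \<Longrightarrow> t \<le> n ! j \<Longrightarrow> i = psum l (Suc j) + psum n j + t \<Longrightarrow>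
    v = int (b (psum n j + t)) \<Longrightarrow> beta_at a b \<alpha> l n i v"
  using beta_at.intros(1)[of j l a b \<alpha> n] beta_at.intros(2)[of j l t a b \<alpha> n]
    beta_at.intros(3)[of j n a b \<alpha> l] beta_at.intros(4)[of j n t a b \<alpha> l] by simp_all

text \<open>With the first run used up, the second word leads, so words and run lists trade places.
  At the head of a run, the sum over \<open>a\<close> loses \<open>a 1\<close>, the sum over
  \<open>b\<close> gains \<open>a 1 - \<alpha> 1\<close> and the sum over \<open>\<alpha>\<close>
  loses \<open>\<alpha> 1\<close>; these changes cancel.\<close>

lemma beta_at_switch:
  assumes le: "\<alpha> 1 \<le> a 1 + b 1" and n: "n \<noteq> []" "\<forall>x\<in>set n. 1 \<le> x" and i: "1 \<le> i"
  shows "beta_at a b \<alpha> (1 # l) n (Suc i) v \<longleftrightarrow>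
    beta_at (absorb a b \<alpha>) (shift a) (shift \<alpha>) n l i v"
proof -
  note head_simps = sum_absorb'[of \<alpha> a b, OF le[unfolded One_nat_def]] sum_shift' shift_Suc
    psum_Suc_pos[OF n, unfolded One_nat_def]
  show ?thesis
  proof
    assume "beta_at a b \<alpha> (1 # l) n (Suc i) v"
    then show "beta_at (absorb a b \<alpha>) (shift a) (shift \<alpha>) n l i v"
    proof cases
      case (1 j)
      \<comment> \<open>The case \<open>j = 0\<close> has index 1, the position of the removed
        y.\<close>
      with i obtain j' where "j = Suc j'" by (cases j) auto
      with 1 show ?thesis
        by (intro beta_at_intros'(3)[of j'])
          (simp_all add: head_simps add.commute)
    next
      case (2 j t)
      then obtain j' where "j = Suc j'" by (cases j) auto
      with 2 show ?thesis
        by (intro beta_at_intros'(4)[of j' _ t]) (simp_all add: shift_def add.commute)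
    next
      case (3 j)
      with sum_absorb[of \<alpha> a b "psum n j + 1", OF le] show ?thesis
        by (intro beta_at_intros'(1)[of j])
          (simp_all add: head_simps add.commute)
    next
      case (4 j t)
      then show ?thesis
        by (intro beta_at_intros'(2)[of j _ t]) (simp_all add: absorb_def add.commute)
    qed
  next
    assume "beta_at (absorb a b \<alpha>) (shift a) (shift \<alpha>) n l i v"
    then show "beta_at a b \<alpha> (1 # l) n (Suc i) v"
    proof cases
      case (1 j)
      with sum_absorb[of \<alpha> a b "psum n j + 1", OF le] show ?thesis
        by (intro beta_at_intros'(3)[of j])
          (simp_all add: head_simps add.commute)
    next
      case (2 j t)
      then show ?thesis
        by (intro beta_at_intros'(4)[of j _ t]) (simp_all add: absorb_def add.commute)
    next
      case (3 j)
      then show ?thesis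
        by (intro beta_at_intros'(1)[of "Suc j"])
          (simp_all add: head_simps add.commute)
    next
      case (4 j t)
      then show ?thesis
        by (intro beta_at_intros'(2)[of "Suc j" _ t]) (simp_all add: shift_def add.commute)
    qed
  qed
qed

text \<open>The same cancellation as for a switch, but the first word keeps leading. The new point
  is that the second position of the old run becomes the head of the shortened one.\<close>

lemma beta_at_continue:
  assumes le: "\<alpha> 1 \<le> a 1 + b 1" and n: "n \<noteq> []" "\<forall>x\<in>set n. 1 \<le> x" and i: "1 \<le> i" and k: "1 \<le> k"
  shows "beta_at a b \<alpha> (Suc k # l) n (Suc i) v \<longleftrightarrow>
    beta_at (shift a) (absorb a b \<alpha>) (shift \<alpha>) (k # l) n i v"
proof -
  note head_simps = sum_absorb'[of \<alpha> a b, OF le[unfolded One_nat_def]] sum_shift' shift_Suc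
    psum_Suc_pos[OF n, unfolded One_nat_def]
  show ?thesis
  proof
    assume "beta_at a b \<alpha> (Suc k # l) n (Suc i) v"
    then show "beta_at (shift a) (absorb a b \<alpha>) (shift \<alpha>) (k # l) n i v"
    proof cases
      case (1 j)
      with i obtain j' where "j = Suc j'" by (cases j) auto
      with 1 show ?thesis
        by (intro beta_at_intros'(1)[of j])
          (simp_all add: head_simps)
    next
      case (2 j t)
      show ?thesis
      proof (cases j)
        case 0
        show ?thesis
        \<comment> \<open>At the new head the sums over \<open>b\<close> and \<open>\<alpha>\<close>
          are empty, so the formula for run heads gives \<open>shift a 1\<close>, which is
          \<open>a 2\<close>.\<close>
        proof (cases "t = 2")
          case True
          with 2 0 show ?thesis
            by (intro beta_at_intros'(1)[of 0]) (simp_all add: shift_def numeral_2_eq_2)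
        next
          case False
          with 2 0 show ?thesis
            by (intro beta_at_intros'(2)[of 0 _ "t - 1"]) (simp_all add: shift_def)
        qed
      next
        case (Suc j')
        with 2 show ?thesis
          by (intro beta_at_intros'(2)[of j _ t]) (simp_all add: shift_def)
      qed
    next
      case (3 j)
      with sum_absorb[of \<alpha> a b "psum n j + 1", OF le] show ?thesis
        by (intro beta_at_intros'(3)[of j])
          (simp_all add: head_simps)
    next
      case (4 j t)
      then show ?thesis
        by (intro beta_at_intros'(4)[of j _ t]) (simp_all add: absorb_def)
    qed
  next
    assume "beta_at (shift a) (absorb a b \<alpha>) (shift \<alpha>) (k # l) n i v"
    then show "beta_at a b \<alpha> (Suc k # l) n (Suc i) v"
    proof cases
      case (1 j)
      show ?thesis
      proof (cases j)
        case 0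
        \<comment> \<open>Conversely, the head of the shortened run is position 2 of the old run,
          which has length at least 2 because \<open>1 \<le> k\<close>.\<close>
        with 1 k show ?thesis
          by (intro beta_at_intros'(2)[of 0 _ 2]) (simp_all add: shift_def numeral_2_eq_2)
      next
        case (Suc j')
        with 1 show ?thesis
          by (intro beta_at_intros'(1)[of j])
            (simp_all add: head_simps)
      qed
    next
      case (2 j t)
      show ?thesis
      proof (cases j)
        case 0
        with 2 show ?thesis
          by (intro beta_at_intros'(2)[of 0 _ "Suc t"]) (simp_all add: shift_def)
      next
        case (Suc j')
        with 2 show ?thesis
          by (intro beta_at_intros'(2)[of j _ t]) (simp_all add: shift_def)
      qed
    next
      case (3 j)
      with sum_absorb[of \<alpha> a b "psum n j + 1", OF le] show ?thesis
        by (intro beta_at_intros'(3)[of j])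
          (simp_all add: head_simps)
    next
      case (4 j t)
      then show ?thesis
        by (intro beta_at_intros'(4)[of j _ t]) (simp_all add: absorb_def)
    qed
  qed
qed

text \<open>The pairs of both the first and the second sum of the coefficient: \<open>n\<close> is as long as \<open>l\<close>
  if the interleaving ends with a run of the second word, and one shorter otherwise.\<close>

definition runs :: "nat \<Rightarrow> nat \<Rightarrow> (nat list \<times> nat list) set" where
  "runs r s = {(l, n). (\<forall>x\<in>set l. 1 \<le> x) \<and> (\<forall>x\<in>set n. 1 \<le> x) \<and> sum_list l = r \<and> sum_list n = s \<and>
     n \<noteq> [] \<and> (length l = length n \<or> length l = Suc (length n))}"

text \<open>This is the upper limit of the binomial products: L_p + s in the first sum of the
  coefficient, r + N_{p-1} in the second.\<close>

definition before_last_run :: "nat list \<Rightarrow> nat list \<Rightarrow> nat" where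
  "before_last_run l n = (if length n < length l then sum_list (butlast l) + sum_list n
     else sum_list l + sum_list (butlast n))"

text \<open>In the last run only one of the two words is left. The exponents there are forced,
  except that the first one is not compared: it is determined by the total degree.\<close>

definition run_term ::
  "nat list \<Rightarrow> nat list \<Rightarrow> (nat \<Rightarrow> nat) \<Rightarrow> (nat \<Rightarrow> nat) \<Rightarrow> (nat \<Rightarrow> nat) \<Rightarrow> nat" where
  "run_term l n a b \<alpha> =
     (\<Prod>i=1..before_last_run l n. binom (int (\<alpha> i)) (beta a b \<alpha> l n i)) *
     (\<Prod>j=before_last_run l n + 2..sum_list l + sum_list n. of_bool (int (\<alpha> j) = beta a b \<alpha> l n j))"

definition run_sum ::
  "nat \<Rightarrow> nat \<Rightarrow> (nat \<Rightarrow> nat) \<Rightarrow> (nat \<Rightarrow> nat) \<Rightarrow> (nat \<Rightarrow> nat) \<Rightarrow> nat" where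
  "run_sum r s a b \<alpha> = (\<Sum>(l, n)\<in>runs r s. run_term l n a b \<alpha>)"

section \<open>Single terms under the removal of the first y\<close>

lemma binom_of_nat: "binom (int m) (int k) = m choose k"
  by (simp add: binom_def)

lemma beta_run:
  assumes "(l, n) \<in> runs r s" "beta_at a b \<alpha> l n i v"
  shows "beta a b \<alpha> l n i = v"
  using assms by (intro beta_eqs) (auto simp: runs_def)

text \<open>At \<open>i = 1\<close> the sums over \<open>b\<close> and \<open>\<alpha>\<close> are
  empty, so the head of the first run follows the same pattern as its other positions.\<close>

lemma beta_first_run:
  assumes "(k # l, n) \<in> runs r s" "1 \<le> i" "i \<le> k"
  shows "beta a b \<alpha> (k # l) n i = int (a i)"
proof (rule beta_run[OF assms(1)])
  show "beta_at a b \<alpha> (k # l) n i (int (a i))"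
  proof (cases "i = 1")
    case True
    then show ?thesis by (intro beta_at_intros'(1)[of 0]) auto
  next
    case False
    with assms show ?thesis by (intro beta_at_intros'(2)[of 0 _ i]) auto
  qed
qed

lemma beta_switch:
  assumes "\<alpha> 1 \<le> a 1 + b 1" "n \<noteq> []" "\<forall>x\<in>set n. 1 \<le> x" "1 \<le> i"
  shows "beta a b \<alpha> (1 # l) n (Suc i) = beta (absorb a b \<alpha>) (shift a) (shift \<alpha>) n l i"
  unfolding beta_def beta_at_switch[of \<alpha> a b, OF assms] ..

lemma beta_continue:
  assumes "\<alpha> 1 \<le> a 1 + b 1" "n \<noteq> []" "\<forall>x\<in>set n. 1 \<le> x" "1 \<le> i" "1 \<le> k"
  shows "beta a b \<alpha> (Suc k # l) n (Suc i) = beta (shift a) (absorb a b \<alpha>) (shift \<alpha>) (k # l) n i"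
  unfolding beta_def beta_at_continue[of \<alpha> a b, OF assms] ..

text \<open>Common to continuing and switching: the factor at 1 splits off and all other indices
  move down by one.\<close>

lemma run_term_step:
  assumes "beta a b \<alpha> l n 1 = int (a 1)"
    and "\<And>i. 1 \<le> i \<Longrightarrow> beta a b \<alpha> l n (Suc i) = beta a' b' (shift \<alpha>) l' n' i"
    and "before_last_run l n = Suc (before_last_run l' n')"
    and "sum_list l + sum_list n = Suc (sum_list l' + sum_list n')"
  shows "run_term l n a b \<alpha> = (\<alpha> 1 choose a 1) * run_term l' n' a' b' (shift \<alpha>)"
proof -
  let ?m = "before_last_run l' n'" and ?N = "sum_list l' + sum_list n'"
  have "(\<Prod>i=1..Suc ?m. binom (int (\<alpha> i)) (beta a b \<alpha> l n i)) =
    binom (int (\<alpha> 1)) (beta a b \<alpha> l n 1) *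
    (\<Prod>i=1..?m. binom (int (\<alpha> (Suc i))) (beta a b \<alpha> l n (Suc i)))"
    by (simp add: prod.atLeast_Suc_atMost prod.shift_bounds_cl_Suc_ivl del: prod.cl_ivl_Suc)
  also have "\<dots> = (\<alpha> 1 choose a 1) *
    (\<Prod>i=1..?m. binom (int (shift \<alpha> i)) (beta a' b' (shift \<alpha>) l' n' i))"
    unfolding assms(1) binom_of_nat
    by (intro arg_cong2[where f = "(*)"] refl prod.cong) (simp_all add: assms(2) shift_def)
  finally have 1: "(\<Prod>i=1..Suc ?m. binom (int (\<alpha> i)) (beta a b \<alpha> l n i)) = \<dots>" .
  have 2: "(\<Prod>j=Suc ?m + 2..Suc ?N. of_bool (int (\<alpha> j) = beta a b \<alpha> l n j) :: nat) =
    (\<Prod>j=?m + 2..?N. of_bool (int (shift \<alpha> j) = beta a' b' (shift \<alpha>) l' n' j))"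
    unfolding add_Suc prod.shift_bounds_cl_Suc_ivl
    by (intro prod.cong) (simp_all add: assms(2) shift_def)
  show ?thesis
    unfolding run_term_def assms(3,4) 1 2 by simp
qed

lemma run_term_continue:
  assumes "\<alpha> 1 \<le> a 1 + b 1" "(k # l, n) \<in> runs r s"
  shows "run_term (Suc k # l) n a b \<alpha> =
    (\<alpha> 1 choose a 1) * run_term (k # l) n (shift a) (absorb a b \<alpha>) (shift \<alpha>)"
proof (rule run_term_step)
  from assms(2) have "(Suc k # l, n) \<in> runs (Suc r) s" by (auto simp: runs_def)
  from beta_first_run[OF this, of 1] show "beta a b \<alpha> (Suc k # l) n 1 = int (a 1)" by simp
  show "beta a b \<alpha> (Suc k # l) n (Suc i) = beta (shift a) (absorb a b \<alpha>) (shift \<alpha>) (k # l) n i"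
    if "1 \<le> i" for i
    using assms that by (intro beta_continue) (auto simp: runs_def)
  show "before_last_run (Suc k # l) n = Suc (before_last_run (k # l) n)"
    using assms(2) by (auto simp: before_last_run_def runs_def)
qed simp

lemma run_term_switch:
  assumes "\<alpha> 1 \<le> a 1 + b 1" "(n, l) \<in> runs s r"
  shows "run_term (1 # l) n a b \<alpha> =
    (\<alpha> 1 choose a 1) * run_term n l (absorb a b \<alpha>) (shift a) (shift \<alpha>)"
proof (rule run_term_step)
  from assms(2) have *: "(1 # l, n) \<in> runs (Suc r) s" by (auto simp: runs_def)
  from beta_first_run[OF this, of 1] show "beta a b \<alpha> (1 # l) n 1 = int (a 1)" by simp
  show "beta a b \<alpha> (1 # l) n (Suc i) = beta (absorb a b \<alpha>) (shift a) (shift \<alpha>) n l i"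
    if "1 \<le> i" for i
    using assms(1) * that by (intro beta_switch) (auto simp: runs_def)
  show "before_last_run (1 # l) n = Suc (before_last_run n l)"
    using assms(2) by (auto simp: before_last_run_def runs_def)
qed simp

lemma sum_list_pos: "l \<noteq> [] \<Longrightarrow> \<forall>x\<in>set l. 1 \<le> x \<Longrightarrow> 1 \<le> sum_list (l :: nat list)"
  by (cases l) auto

text \<open>Here all y's of the first word come first. The only position where \<beta> depends on
  \<open>\<alpha>\<close> is \<open>r + 1\<close>, and neither product contains it.\<close>

lemma run_term_single:
  assumes "1 \<le> r" "1 \<le> s"
  shows "run_term [r] [s] a b \<alpha> =
    (\<Prod>i=1..r. \<alpha> i choose a i) * of_bool (\<forall>j\<in>{2..s}. \<alpha> (r + j) = b j)"
proof -
  have runs: "([r], [s]) \<in> runs r s" using assms by (auto simp: runs_def)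
  have m: "before_last_run [r] [s] = r" by (simp add: before_last_run_def)
  have "(\<Prod>i=1..r. binom (int (\<alpha> i)) (beta a b \<alpha> [r] [s] i)) = (\<Prod>i=1..r. \<alpha> i choose a i)"
    by (intro prod.cong) (simp_all add: beta_first_run[OF runs] binom_of_nat)
  moreover have "(\<Prod>j=r+2..r+s. of_bool (int (\<alpha> j) = beta a b \<alpha> [r] [s] j) :: nat) =
    (\<Prod>j=2..s. of_bool (\<alpha> (r + j) = b j))"
  proof (intro prod.reindex_bij_witness[of _ "\<lambda>j. r + j" "\<lambda>j. j - r"])
    fix j assume j: "j \<in> {r + 2..r + s}"
    have "beta a b \<alpha> [r] [s] j = int (b (j - r))"
      using j by (intro beta_run[OF runs] beta_at_intros'(4)[of 0 _ "j - r"]) auto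
    then show "of_bool (\<alpha> (r + (j - r)) = b (j - r)) =
      (of_bool (int (\<alpha> j) = beta a b \<alpha> [r] [s] j) :: nat)"
      using j by simp
  qed auto
  moreover have "(\<Prod>j=2..s. of_bool (\<alpha> (r + j) = b j) :: nat) = of_bool (\<forall>j\<in>{2..s}. \<alpha> (r + j) = b j)"
    by (auto simp: prod_zero_iff intro!: prod.neutral)
  ultimately show ?thesis
    unfolding run_term_def m by simp
qed

lemma sum_add_split: "(\<Sum>i=1..r + s. f i) = (\<Sum>i=1..r. f i) + (\<Sum>j=1..s. f (r + j))"
  for f :: "nat \<Rightarrow> nat"
  by (induction s) simp_all

text \<open>Combined with the total degree, this determines the exponent
  \<open>\<alpha> (Suc r)\<close> that the term leaves uncompared.\<close>

lemma sum_tail_eq: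
  fixes \<alpha> b :: "nat \<Rightarrow> nat"
  assumes "1 \<le> s" "\<forall>j\<in>{2..s}. \<alpha> (r + j) = b j"
  shows "(\<Sum>j=1..s. \<alpha> (r + j)) + b 1 = \<alpha> (Suc r) + (\<Sum>j=1..s. b j)"
proof -
  have "(\<Sum>j=2..s. \<alpha> (r + j)) = (\<Sum>j=2..s. b j)"
    using assms(2) by (intro sum.cong) auto
  then show ?thesis
    unfolding sum_split_first[OF assms(1)] by simp
qed

text \<open>If the first gap has too many letters, then either the first run of the second word
  starts with a negative \<open>\<beta>\<close>, or there is no other run and the total degree is exceeded.\<close>

lemma run_term_eq_0:
  assumes runs: "(l, n) \<in> runs r s"
    and total: "(\<Sum>i=1..r + s. \<alpha> i) = (\<Sum>i=1..r. a i) + (\<Sum>j=1..s. b j)"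
    and gt: "a 1 + b 1 < \<alpha> 1"
  shows "run_term l n a b \<alpha> = 0"
proof (rule ccontr)
  assume nz: "run_term l n a b \<alpha> \<noteq> 0"
  obtain k l' where l: "l = k # l'" using runs by (cases l) (auto simp: runs_def)
  obtain k2 n' where n: "n = k2 # n'" using runs by (cases n) (auto simp: runs_def)
  have pos: "1 \<le> k" "1 \<le> k2" using runs by (auto simp: runs_def l n)
  have km: "k \<le> before_last_run l n"
    using runs by (auto simp: before_last_run_def runs_def l n)
  have binom_nz: "binom (int (\<alpha> i)) (beta a b \<alpha> l n i) \<noteq> 0"
    if "1 \<le> i" "i \<le> before_last_run l n" for i
    using nz that by (auto simp: run_term_def)
  have a_le: "a i \<le> \<alpha> i" if "1 \<le> i" "i \<le> k" for i
    using binom_nz[of i] that km beta_first_run[OF runs[unfolded l], of i a b \<alpha>]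
    by (auto simp: l binom_def split: if_splits)
  have "(\<Sum>i=2..k. a i) \<le> (\<Sum>i=2..k. \<alpha> i)"
    using a_le by (intro sum_mono) auto
  \<comment> \<open>The excess in the first gap persists to the end of the first run, since nonzero
    binomials force \<open>a i \<le> \<alpha> i\<close> there.\<close>
  then have lt: "(\<Sum>i=1..k. a i) + b 1 < (\<Sum>i=1..k. \<alpha> i)"
    using gt unfolding sum_split_first[OF pos(1)] by simp
  show False
  proof (cases "k = before_last_run l n")
    case False
    have "beta a b \<alpha> l n (k + 1) =
      int (\<Sum>i=1..k. a i) + int (b 1) - int (\<Sum>i=1..k. \<alpha> i)"
      by (intro beta_run[OF runs] beta_at_intros'(3)[of 0]) (simp_all add: l n)
    with lt have "beta a b \<alpha> l n (k + 1) < 0" by linarith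
    then show False
      using binom_nz[of "k + 1"] km False by (simp add: binom_def)
  next
    case True
    \<comment> \<open>The last run starts right after the first, and all parts are positive, so
      there are just two runs.\<close>
    then have "l' = []"
      using runs pos by (cases "l' = []") (auto simp: before_last_run_def runs_def l n split: if_splits)
    then have "n' = []" "r = k" "s = k2" using runs by (auto simp: l n runs_def)
    with nz \<open>l' = []\<close> have "\<forall>j\<in>{2..s}. \<alpha> (r + j) = b j"
      using run_term_single[of k k2 a b \<alpha>] pos by (auto simp: l n split: if_splits)
    from sum_tail_eq[OF _ this] pos lt total sum_add_split[of \<alpha> r s]
    show False unfolding \<open>r = k\<close> \<open>s = k2\<close> by linarith
  qed
qed

section \<open>The recursion for the sum over interleavings\<close>

lemma finite_runs: "finite (runs r s)"
proof (rule finite_subset)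
  show "runs r s \<subseteq> (\<Union>p\<le>r. compositions p r) \<times> (\<Union>p\<le>s. compositions p s)"
    using length_le_sum_list by (fastforce simp: runs_def compositions_def)
qed (auto intro: finite_compositions)

text \<open>Putting the first y back either lengthens the leading run of its own word or forms a new
  run of length 1 before a run of the other word; hence the exchanged lists. With
  \<open>1 \<le> r\<close> the remaining list \<open>l\<close> is nonempty, as
  \<open>runs s r\<close> demands.\<close>

lemma runs_Suc:
  assumes "1 \<le> r"
  shows "runs (Suc r) s = (\<lambda>(l, n). (Suc (hd l) # tl l, n)) ` runs r s \<union> (\<lambda>(n, l). (1 # l, n)) ` runs s r"
    (is "_ = ?A \<union> ?B")
proof
  show "?A \<union> ?B \<subseteq> runs (Suc r) s"
  proof -
    have "(Suc (hd l) # tl l, n) \<in> runs (Suc r) s" if "(l, n) \<in> runs r s" for l n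
      using that by (cases l) (auto simp: runs_def)
    moreover have "(1 # l, n) \<in> runs (Suc r) s" if "(n, l) \<in> runs s r" for l n
      using that by (auto simp: runs_def)
    ultimately show ?thesis by auto
  qed
  show "runs (Suc r) s \<subseteq> ?A \<union> ?B"
  proof
    fix x assume x: "x \<in> runs (Suc r) s"
    then have "fst x \<noteq> []" by (auto simp: runs_def)
    then obtain k l n where kln: "x = (k # l, n)" by (metis list.exhaust prod.collapse)
    with x have k: "1 \<le> k" by (auto simp: runs_def)
    show "x \<in> ?A \<union> ?B"
    proof (cases "k = 1")
      case True
      with x kln assms have "(n, l) \<in> runs s r" by (auto simp: runs_def)
      then have "x \<in> ?B" unfolding kln True by (rule rev_image_eqI) simp
      then show ?thesis ..
    next
      case False
      with x kln k have "((k - 1) # l, n) \<in> runs r s" by (auto simp: runs_def)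
      then have "x \<in> ?A" unfolding kln by (rule rev_image_eqI) (use k in simp)
      then show ?thesis ..
    qed
  qed
qed

lemma run_sum_eq_0:
  assumes "(\<Sum>i=1..r + s. \<alpha> i) = (\<Sum>i=1..r. a i) + (\<Sum>j=1..s. b j)" "a 1 + b 1 < \<alpha> 1"
  shows "run_sum r s a b \<alpha> = 0"
  unfolding run_sum_def using run_term_eq_0[OF _ assms] by (intro sum.neutral) auto

lemma run_sum_Suc:
  assumes "1 \<le> r" "\<alpha> 1 \<le> a 1 + b 1"
  shows "run_sum (Suc r) s a b \<alpha> = (\<alpha> 1 choose a 1) *
    (run_sum r s (shift a) (absorb a b \<alpha>) (shift \<alpha>) + run_sum s r (absorb a b \<alpha>) (shift a) (shift \<alpha>))"
proof -
  let ?f = "\<lambda>(l, n). run_term l n a b \<alpha>"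
  let ?g = "\<lambda>(l, n). (Suc (hd l) # tl l, n :: nat list)" and ?h = "\<lambda>(n :: nat list, l). (1 # l, n)"
  have ne: "l \<noteq> [] \<and> 1 \<le> hd l" if "(l, n) \<in> runs r s" for l n
    using that by (cases l) (auto simp: runs_def)
  have "inj_on ?g (runs r s)"
  proof (rule inj_onI)
    fix x y assume xy: "x \<in> runs r s" "y \<in> runs r s" and eq: "?g x = ?g y"
    have "fst x \<noteq> []" "fst y \<noteq> []" using xy ne by (cases x; cases y; auto)+
    with eq show "x = y" by (auto simp: case_prod_unfold intro: prod_eqI list.expand)
  qed
  moreover have "inj_on ?h (runs s r)" by (auto simp: inj_on_def)
  \<comment> \<open>The first run has length at least 2 in one image and 1 in the other.\<close>
  moreover have "?g ` runs r s \<inter> ?h ` runs s r = {}"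
    by (auto dest: ne)
  ultimately have "run_sum (Suc r) s a b \<alpha> = sum (?f \<circ> ?g) (runs r s) + sum (?f \<circ> ?h) (runs s r)"
    unfolding run_sum_def runs_Suc[OF assms(1)]
    by (simp add: sum.union_disjoint finite_runs sum.reindex)
  also have "sum (?f \<circ> ?g) (runs r s) =
    (\<alpha> 1 choose a 1) * run_sum r s (shift a) (absorb a b \<alpha>) (shift \<alpha>)"
    unfolding run_sum_def sum_distrib_left
  proof (intro sum.cong refl)
    fix x assume x: "x \<in> runs r s"
    then have "fst x \<noteq> []" using ne by (cases x) auto
    then obtain k l n where "x = (k # l, n)" by (metis list.exhaust prod.collapse)
    with x run_term_continue[of \<alpha> a b, OF assms(2), of k l n r s]
    show "(?f \<circ> ?g) x = (\<alpha> 1 choose a 1) *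
      (case x of (l, n) \<Rightarrow> run_term l n (shift a) (absorb a b \<alpha>) (shift \<alpha>))"
      by simp
  qed
  also have "sum (?f \<circ> ?h) (runs s r) =
    (\<alpha> 1 choose a 1) * run_sum s r (absorb a b \<alpha>) (shift a) (shift \<alpha>)"
    unfolding run_sum_def sum_distrib_left
    by (intro sum.cong) (auto simp: run_term_switch[of \<alpha> a b, OF assms(2), unfolded One_nat_def])
  finally show ?thesis by (simp add: distrib_left)
qed

lemma runs_1:
  assumes "1 \<le> s"
  shows "runs 1 s = {([1], [s])}"
proof -
  have "l = [1] \<and> n = [s]" if "(l, n) \<in> runs 1 s" for l n
  proof -
    from that have "l \<noteq> []" by (auto simp: runs_def)
    then obtain k l' where l: "l = k # l'" by (cases l) auto
    have "l' = []"
      using that sum_list_pos[of l'] by (cases "l' = []") (auto simp: l runs_def)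
    then show ?thesis
      using that by (cases n) (auto simp: l runs_def)
  qed
  then show ?thesis using assms by (auto simp: runs_def)
qed

text \<open>Base of the recursion: once the only y of the first word is gone, the rest has to be the
  modified second word itself, as in a shuffle with the empty word.\<close>

lemma run_sum_1:
  assumes "1 \<le> s" "\<alpha> 1 \<le> a 1 + b 1"
    and total: "(\<Sum>i=1..1 + s. \<alpha> i) = a 1 + (\<Sum>j=1..s. b j)"
  shows "run_sum 1 s a b \<alpha> =
    (\<alpha> 1 choose a 1) * of_bool (\<forall>i\<in>{1..s}. shift \<alpha> i = absorb a b \<alpha> i)"
proof -
  \<comment> \<open>The total degree supplies the one comparison that \<open>run_term\<close>
    omits.\<close>
  have "\<alpha> 2 = a 1 + b 1 - \<alpha> 1" if "\<forall>j\<in>{2..s}. \<alpha> (1 + j) = b j"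
    using sum_tail_eq[OF assms(1) that] total assms(2) sum_add_split[of \<alpha> 1 s]
    by (simp add: numeral_2_eq_2)
  moreover have "{1..s} = insert 1 {2..s}" using assms(1) by auto
  then have "(\<forall>i\<in>{1..s}. shift \<alpha> i = absorb a b \<alpha> i) \<longleftrightarrow>
    \<alpha> 2 = a 1 + b 1 - \<alpha> 1 \<and> (\<forall>j\<in>{2..s}. \<alpha> (1 + j) = b j)"
    by (auto simp: shift_def absorb_def numeral_2_eq_2)
  ultimately show ?thesis
    using assms(1) by (auto simp: run_sum_def runs_1[unfolded One_nat_def] run_term_single[of "Suc 0"])
qed

section \<open>The common recursion\<close>

lemma xy_word_absorb:
  assumes "1 \<le> s"
  shows "xy_word s (absorb a b \<alpha>) =
    replicate (a 1 + b 1 - \<alpha> 1) X @ Y # xy_word (s - 1) (shift b)"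
proof -
  obtain s' where s: "s = Suc s'" using assms by (cases s) auto
  have "xy_word s' (shift (absorb a b \<alpha>)) = xy_word s' (shift b)"
    by (rule xy_word_cong) (simp add: shift_def absorb_def)
  then show ?thesis by (simp add: s xy_word_Suc) (simp add: absorb_def)
qed

lemma sum_shift_nat: "(\<Sum>i=1..Suc m. f i) = f 1 + (\<Sum>i=1..m. shift f i)" for f :: "nat \<Rightarrow> nat"
  by (induction m) (simp_all add: shift_def)

lemma sum_absorb_nat:
  assumes "\<alpha> 1 \<le> a 1 + b 1" "1 \<le> s"
  shows "(\<Sum>i=1..s. absorb a b \<alpha> i) + \<alpha> 1 = (\<Sum>i=1..s. b i) + a 1"
proof -
  have "int ((\<Sum>i=1..s. absorb a b \<alpha> i) + \<alpha> 1) = int ((\<Sum>i=1..s. b i) + a 1)"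
    using sum_absorb[of \<alpha> a b, OF assms] by simp
  then show ?thesis by (simp only: of_nat_eq_iff)
qed

text \<open>The shuffles whose first \<open>y\<close> comes from the first word.\<close>

definition first_y_coeff ::
  "nat \<Rightarrow> nat \<Rightarrow> (nat \<Rightarrow> nat) \<Rightarrow> (nat \<Rightarrow> nat) \<Rightarrow> (nat \<Rightarrow> nat) \<Rightarrow> rat" where
  "first_y_coeff r s a b \<alpha> = (if \<alpha> 1 \<le> a 1 + b 1 then of_nat (\<alpha> 1 choose a 1) *
     Poly_Mapping.lookup (shuffle_words (xy_word (r - 1) (shift a)) (xy_word s (absorb a b \<alpha>)))
       (xy_word (r + s - 1) (shift \<alpha>)) else 0)"

lemma lookup_shuffle_words_commute:
  "Poly_Mapping.lookup (shuffle_words u v) w = Poly_Mapping.lookup (shuffle_words v u) w"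
proof -
  have "shuffle_words u v = shuffle_words v u"
    by (induction u v rule: shuffle_words.induct) (simp_all add: add.commute)
  then show ?thesis by simp
qed

text \<open>The first y comes from one word or the other; commutativity brings the second case into
  the form of the first.\<close>

lemma lookup_shuffle_words_xy:
  assumes "1 \<le> r" "1 \<le> s"
  shows "Poly_Mapping.lookup (shuffle_words (xy_word r a) (xy_word s b)) (xy_word (r + s) \<alpha>) =
    first_y_coeff r s a b \<alpha> + first_y_coeff s r b a \<alpha>"
proof -
  obtain r' where r: "r = Suc r'" using assms by (cases r) auto
  obtain s' where s: "s = Suc s'" using assms by (cases s) auto
  have "xy_word (r + s) \<alpha> = replicate (\<alpha> 1) X @ Y # xy_word (r + s - 1) (shift \<alpha>)"
    by (simp add: r xy_word_Suc)
  then show ?thesis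
    unfolding first_y_coeff_def xy_word_absorb[OF assms(1)] xy_word_absorb[OF assms(2)]
    by (simp add: r s xy_word_Suc lookup_shuffle_words_step
        lookup_shuffle_words_commute[of "xy_word s' (shift b)"] add.commute)
qed

text \<open>Induction on the number of y's. Both sides split by the origin of the first y, and each
  half reduces to a full coefficient with one y less, so both run sums must appear in the
  statement.\<close>

lemma lookup_shuffle_words_run_sum:
  assumes "1 \<le> r" "1 \<le> s" "(\<Sum>i=1..r + s. \<alpha> i) = (\<Sum>i=1..r. a i) + (\<Sum>j=1..s. b j)"
  shows "Poly_Mapping.lookup (shuffle_words (xy_word r a) (xy_word s b)) (xy_word (r + s) \<alpha>) =
    of_nat (run_sum r s a b \<alpha> + run_sum s r b a \<alpha>)"
  using assms
proof (induction "r + s" arbitrary: r s a b \<alpha> rule: less_induct)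
  case less
  \<comment> \<open>The induction hypothesis is a premise here, so that this half can be applied to
    the words in both orders.\<close>
  have half: "first_y_coeff r s a b \<alpha> = of_nat (run_sum r s a b \<alpha>)"
    if "1 \<le> r" "1 \<le> s" and total: "(\<Sum>i=1..r + s. \<alpha> i) = (\<Sum>i=1..r. a i) + (\<Sum>j=1..s. b j)"
      and IH: "\<And>r' s' a b \<alpha>. r' + s' < r + s \<Longrightarrow> 1 \<le> r' \<Longrightarrow> 1 \<le> s' \<Longrightarrow>
        (\<Sum>i=1..r' + s'. \<alpha> i) = (\<Sum>i=1..r'. a i) + (\<Sum>j=1..s'. b j) \<Longrightarrow>
        Poly_Mapping.lookup (shuffle_words (xy_word r' a) (xy_word s' b)) (xy_word (r' + s') \<alpha>) =
        of_nat (run_sum r' s' a b \<alpha> + run_sum s' r' b a \<alpha>)"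
    for r s a b \<alpha>
  proof (cases "\<alpha> 1 \<le> a 1 + b 1")
    case False
    with run_sum_eq_0[OF total] show ?thesis by (simp add: first_y_coeff_def)
  next
    case le: True
    show ?thesis
    proof (cases "r = 1")
      case True
      have "(\<Sum>i=1..1 + s. \<alpha> i) = a 1 + (\<Sum>j=1..s. b j)" using total by (simp add: True)
      from run_sum_1[of s \<alpha> a b, OF \<open>1 \<le> s\<close> le this] show ?thesis
        using le by (auto simp: first_y_coeff_def True lookup_of_word' xy_word_eq_iff)
    next
      case False
      then obtain r' where r: "r = Suc r'" "1 \<le> r'" using \<open>1 \<le> r\<close> by (cases r) auto
      have "(\<Sum>i=1..r' + s. shift \<alpha> i) = (\<Sum>i=1..r'. shift a i) + (\<Sum>j=1..s. absorb a b \<alpha> j)"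
        using total sum_absorb_nat[of \<alpha> a b, OF le \<open>1 \<le> s\<close>]
        unfolding r(1) add_Suc sum_shift_nat by linarith
      from IH[OF _ r(2) \<open>1 \<le> s\<close> this] show ?thesis
        using le run_sum_Suc[of r' \<alpha> a b s, OF r(2) le] by (simp add: first_y_coeff_def r)
    qed
  qed
  have "first_y_coeff r s a b \<alpha> = of_nat (run_sum r s a b \<alpha>)"
    using less.prems by (intro half less.hyps)
  moreover have "first_y_coeff s r b a \<alpha> = of_nat (run_sum s r b a \<alpha>)"
    using less.prems by (intro half less.hyps) (simp_all add: add.commute)
  ultimately show ?case
    by (simp add: lookup_shuffle_words_xy[OF less.prems(1,2)])
qed

section \<open>From interleavings to the four sums of the coefficient\<close>

lemma sum_composition_pairs:
  "(\<Sum>(p, l, n)\<in>(SIGMA p:{1..}. compositions (f p) r \<times> compositions p s). g p l n) =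
   (\<Sum>(l, n)\<in>{(l, n). n \<noteq> [] \<and> l \<in> compositions (f (length n)) r \<and> n \<in> compositions (length n) s}.
      g (length n) l n)"
  \<comment> \<open>Here \<open>p\<close> is recovered as \<open>length n\<close>, and
    \<open>1 \<le> p\<close> turns into \<open>n \<noteq> []\<close>.\<close>
  by (rule sum.reindex_bij_witness[of _ "\<lambda>(l, n). (length n, l, n)" "\<lambda>(p, l, n). (l, n)"])
    (auto simp: compositions_def Suc_le_eq)

text \<open>The two pieces are the interleavings that end with the first and with the second
  word.\<close>

lemma runs_split:
  "runs r s =
    {(l, n). n \<noteq> [] \<and> l \<in> compositions (length n + 1) r \<and> n \<in> compositions (length n) s} \<union>
    {(l, n). n \<noteq> [] \<and> l \<in> compositions (length n) r \<and> n \<in> compositions (length n) s}"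
  by (auto simp: runs_def compositions_def)

lemma psum_butlast: "psum l (length l - 1) = sum_list (butlast l)"
  by (simp add: psum_def butlast_conv_take)

lemma psum_ge: "length l \<le> j \<Longrightarrow> psum l j = sum_list l"
  by (simp add: psum_def)

lemma psum_last: "l \<noteq> [] \<Longrightarrow> psum l (length l - 1) + l ! (length l - 1) = sum_list l"
  using psum_Suc[of "length l - 1" l] by (simp add: psum_ge)

text \<open>All \<open>s\<close> y's of the second word lie before the last run, so position
  \<open>j\<close> in it is position \<open>j - s\<close> of the first word.\<close>

lemma run_term_last_a:
  assumes "(l, n) \<in> runs r s" "length l = length n + 1"
  shows "run_term l n a b \<alpha> =
    (\<Prod>i=1..psum l (length n) + s. binom (int (\<alpha> i)) (beta a b \<alpha> l n i)) *
    (\<Prod>j=psum l (length n) + s + 2..r + s. of_bool (\<alpha> j = a (j - s)))"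
proof -
  have rs: "sum_list l = r" "sum_list n = s" and "l \<noteq> []" using assms by (auto simp: runs_def)
  have m: "before_last_run l n = psum l (length n) + s"
    using assms psum_butlast[of l] by (simp add: before_last_run_def rs)
  have "beta a b \<alpha> l n j = int (a (j - s))" if "j \<in> {psum l (length n) + s + 2..r + s}" for j
    using that assms psum_last[OF \<open>l \<noteq> []\<close>]
    \<comment> \<open>Counting from 0, \<open>length n\<close> is the index of the last part of
      \<open>l\<close>; the offset in that run is at least 2, past its head.\<close>
    by (intro beta_run[OF assms(1)] beta_at_intros'(2)[of "length n" _ "j - (psum l (length n) + s)"])
      (auto simp: psum_ge rs)
  then show ?thesis by (simp add: run_term_def m rs)
qed

lemma run_term_last_b:
  assumes "(l, n) \<in> runs r s" "length l = length n"
  shows "run_term l n a b \<alpha> =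
    (\<Prod>i=1..r + psum n (length n - 1). binom (int (\<alpha> i)) (beta a b \<alpha> l n i)) *
    (\<Prod>j=r + psum n (length n - 1) + 2..r + s. of_bool (\<alpha> j = b (j - r)))"
proof -
  have rs: "sum_list l = r" "sum_list n = s" "n \<noteq> []" using assms by (auto simp: runs_def)
  have m: "before_last_run l n = r + psum n (length n - 1)"
    using assms psum_butlast[of n] by (simp add: before_last_run_def rs)
  have "beta a b \<alpha> l n j = int (b (j - r))" if "j \<in> {r + psum n (length n - 1) + 2..r + s}" for j
    using that assms psum_last[OF rs(3)] rs(3)
    by (intro beta_run[OF assms(1)]
        beta_at_intros'(4)[of "length n - 1" _ "j - (r + psum n (length n - 1))"])
      (auto simp: psum_ge rs)
  then show ?thesis by (simp add: run_term_def m rs)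
qed

lemma run_sum_eq:
  "run_sum r s a b \<alpha> =
     (\<Sum>(p, l, n) \<in> (SIGMA p:{1..}. compositions (p + 1) r \<times> compositions p s).
        (\<Prod>i=1..psum l p + s. binom (int (\<alpha> i)) (beta a b \<alpha> l n i)) *
        (\<Prod>j=psum l p + s + 2..r + s. of_bool (\<alpha> j = a (j - s))))
   + (\<Sum>(p, l, n) \<in> (SIGMA p:{1..}. compositions p r \<times> compositions p s).
        (\<Prod>i=1..r + psum n (p - 1). binom (int (\<alpha> i)) (beta a b \<alpha> l n i)) *
        (\<Prod>j=r + psum n (p - 1) + 2..r + s. of_bool (\<alpha> j = b (j - r))))"
  (is "_ = ?S1 + ?S2")
proof -
  let ?A = "{(l, n). n \<noteq> [] \<and> l \<in> compositions (length n + 1) r \<and> n \<in> compositions (length n) s}"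
  let ?B = "{(l, n). n \<noteq> [] \<and> l \<in> compositions (length n) r \<and> n \<in> compositions (length n) s}"
  have "finite ?A" "finite ?B"
    using finite_runs[of r s] unfolding runs_split by simp_all
  moreover have "?A \<inter> ?B = {}" by (auto simp: compositions_def)
  ultimately have "run_sum r s a b \<alpha> =
    (\<Sum>(l, n)\<in>?A. run_term l n a b \<alpha>) + (\<Sum>(l, n)\<in>?B. run_term l n a b \<alpha>)"
    unfolding run_sum_def runs_split by (rule sum.union_disjoint)
  also have "(\<Sum>(l, n)\<in>?A. run_term l n a b \<alpha>) = ?S1"
    unfolding sum_composition_pairs
  proof (intro sum.cong refl, clarify)
    fix l n assume "n \<noteq> []" "l \<in> compositions (length n + 1) r" "n \<in> compositions (length n) s"
    then have "(l, n) \<in> runs r s" "length l = length n + 1"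
      by (auto simp: runs_split compositions_def)
    then show "run_term l n a b \<alpha> =
      (\<Prod>i=1..psum l (length n) + s. binom (int (\<alpha> i)) (beta a b \<alpha> l n i)) *
      (\<Prod>j=psum l (length n) + s + 2..r + s. of_bool (\<alpha> j = a (j - s)))"
      by (rule run_term_last_a)
  qed
  also have "(\<Sum>(l, n)\<in>?B. run_term l n a b \<alpha>) = ?S2"
    unfolding sum_composition_pairs
  proof (intro sum.cong refl, clarify)
    fix l n assume "n \<noteq> []" "l \<in> compositions (length n) r" "n \<in> compositions (length n) s"
    then have "(l, n) \<in> runs r s" "length l = length n"
      by (auto simp: runs_split compositions_def)
    then show "run_term l n a b \<alpha> =
      (\<Prod>i=1..r + psum n (length n - 1). binom (int (\<alpha> i)) (beta a b \<alpha> l n i)) *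
      (\<Prod>j=r + psum n (length n - 1) + 2..r + s. of_bool (\<alpha> j = b (j - r)))"
      by (rule run_term_last_b)
  qed
  finally show ?thesis .
qed

lemma gamma_eq_beta: "gamma a b \<alpha> l n = beta b a \<alpha> n l"
  by (simp add: fun_eq_iff gamma_def beta_def gamma_at_iff_beta_at)

lemma sum_composition_pairs_swap:
  "(\<Sum>(p, l, n)\<in>(SIGMA p:{1..}. compositions (f p) r \<times> compositions (g p) s). h p l n) =
   (\<Sum>(p, n, l)\<in>(SIGMA p:{1..}. compositions (g p) s \<times> compositions (f p) r). h p l n)"
  by (rule sum.reindex_bij_witness[of _ "\<lambda>(p, n, l). (p, l, n)" "\<lambda>(p, l, n). (p, n, l)"]) auto

text \<open>After the exchange of words and lists, the third and fourth sums are the first and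
  second sums of \<open>run_sum s r b a\<close>.\<close>

lemma shuffle_coeff_eq: "shuffle_coeff r s a b \<alpha> = run_sum r s a b \<alpha> + run_sum s r b a \<alpha>"
proof -
  have "(\<Sum>(p, l, n) \<in> (SIGMA p:{1..}. compositions p r \<times> compositions (p + 1) s).
        (\<Prod>i=1..r + psum n p. binom (int (\<alpha> i)) (gamma a b \<alpha> l n i)) *
        (\<Prod>j=r + psum n p + 2..r + s. of_bool (\<alpha> j = b (j - r)))) =
      (\<Sum>(p, l, n) \<in> (SIGMA p:{1..}. compositions (p + 1) s \<times> compositions p r).
        (\<Prod>i=1..psum l p + r. binom (int (\<alpha> i)) (beta b a \<alpha> l n i)) *
        (\<Prod>j=psum l p + r + 2..s + r. of_bool (\<alpha> j = b (j - r))) :: nat)"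
    unfolding gamma_eq_beta
    by (subst sum_composition_pairs_swap) (simp only: add.commute[of r])
  moreover have "(\<Sum>(p, l, n) \<in> (SIGMA p:{1..}. compositions p r \<times> compositions p s).
        (\<Prod>i=1..psum l (p - 1) + s. binom (int (\<alpha> i)) (gamma a b \<alpha> l n i)) *
        (\<Prod>j=psum l (p - 1) + s + 2..r + s. of_bool (\<alpha> j = a (j - s)))) =
      (\<Sum>(p, l, n) \<in> (SIGMA p:{1..}. compositions p s \<times> compositions p r).
        (\<Prod>i=1..s + psum n (p - 1). binom (int (\<alpha> i)) (beta b a \<alpha> l n i)) *
        (\<Prod>j=s + psum n (p - 1) + 2..s + r. of_bool (\<alpha> j = a (j - s))) :: nat)"
    unfolding gamma_eq_beta
    by (subst sum_composition_pairs_swap) (simp only: add.commute[of s])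
  ultimately show ?thesis
    unfolding shuffle_coeff_def run_sum_eq[of r s] run_sum_eq[of s r] by (simp only: add.assoc)
qed

section \<open>Assembling the expansion from its coefficients\<close>

theorem theorem2p1:
  fixes r s :: nat and a b :: "nat \<Rightarrow> nat"
  assumes "1 \<le> r" and "1 \<le> s"
  shows "of_word (xy_word r a) \<squnion>\<squnion> of_word (xy_word s b) =
    (\<Sum>\<alpha> \<in> weak_compositions (r + s) ((\<Sum>i=1..r. a i) + (\<Sum>j=1..s. b j)).
       scale (of_nat (shuffle_coeff r s a b \<alpha>)) (of_word (xy_word (r + s) \<alpha>)))"
proof -
  let ?W = "weak_compositions (r + s) ((\<Sum>i=1..r. a i) + (\<Sum>j=1..s. b j))"
  let ?c = "\<lambda>\<alpha>. rat_of_nat (shuffle_coeff r s a b \<alpha>)"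
  have "Poly_Mapping.lookup (shuffle_words (xy_word r a) (xy_word s b)) w =
    (\<Sum>\<alpha>\<in>?W. ?c \<alpha> * of_bool (xy_word (r + s) \<alpha> = w))" for w
  proof (cases "\<exists>\<alpha>\<in>?W. w = xy_word (r + s) \<alpha>")
    case True
    then obtain \<alpha> where \<alpha>: "\<alpha> \<in> ?W" "w = xy_word (r + s) \<alpha>" by blast
    \<comment> \<open>The word fixes the exponents on \<open>{1..r + s}\<close>, and members of
      \<open>?W\<close> agree outside it, so exactly one summand survives.\<close>
    have "xy_word (r + s) \<alpha>' = w \<longleftrightarrow> \<alpha>' = \<alpha>" if "\<alpha>' \<in> ?W" for \<alpha>'
      using that \<alpha> PiE_ext[of \<alpha>' "{1..r + s}" "\<lambda>_. UNIV" \<alpha>]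
      by (auto simp: xy_word_eq_iff weak_compositions_def)
    then have "(\<Sum>\<alpha>'\<in>?W. ?c \<alpha>' * of_bool (xy_word (r + s) \<alpha>' = w)) =
      (\<Sum>\<alpha>'\<in>?W. if \<alpha>' = \<alpha> then ?c \<alpha> else 0)"
      by (intro sum.cong) auto
    also have "\<dots> = ?c \<alpha>" using \<alpha>(1) by (simp add: finite_weak_compositions)
    finally show ?thesis
      using \<alpha> assms by (simp add: lookup_shuffle_words_run_sum weak_compositions_def shuffle_coeff_eq)
  next
    case False
    have "Poly_Mapping.lookup (shuffle_words (xy_word r a) (xy_word s b)) w = 0"
    \<comment> \<open>A word in the support ends in y and has the right numbers of x and y, so it
      would come from a member of \<open>?W\<close>.\<close>
    proof (rule ccontr)
      assume nz: "Poly_Mapping.lookup (shuffle_words (xy_word r a) (xy_word s b)) w \<noteq> 0"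
      note count = lookup_shuffle_words_neq_0(1)[OF nz]
      have "w = [] \<or> last w = Y"
        using lookup_shuffle_words_neq_0(2)[OF nz] last_xy_word assms by blast
      then obtain k e where e: "w = xy_word k e" using ends_in_Y_imp_xy_word by blast
      have k: "k = r + s" using count[of Y] by (simp add: e xy_word_count)
      \<comment> \<open>Restricting gives \<open>e\<close> the default value outside the index range
        that membership in \<open>?W\<close> requires; the word does not change.\<close>
      have "restrict e {1..r + s} \<in> ?W"
        using count[of X] by (auto simp: weak_compositions_def e k xy_word_count)
      moreover have "w = xy_word (r + s) (restrict e {1..r + s})"
        unfolding e k by (rule xy_word_cong) simp
      ultimately show False using False by blast
    qed
    moreover have "?c \<alpha> * of_bool (xy_word (r + s) \<alpha> = w) = 0" if "\<alpha> \<in> ?W" for \<alpha>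
      using False that by auto
    then have "(\<Sum>\<alpha>\<in>?W. ?c \<alpha> * of_bool (xy_word (r + s) \<alpha> = w)) = 0"
      by (intro sum.neutral) blast
    ultimately show ?thesis by simp
  qed
  then show ?thesis
    unfolding shuffle_of_word
    by (intro poly_mapping_eqI) (simp add: lookup_sum lookup_scale lookup_of_word')
qed

end
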